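(* Let $\alpha>0$. (i) Let $X$ be a non-negative and absolutely continuous random variable with cumulative distribution function $F$, and let $\breve L_\alpha$ be its $\alpha$-generalized reversed aging intensity function. Then $$F(x)=\left[1-\exp\left(-\int_0^x \frac{\breve L_{\alpha}(t)}{t}\,\mathrm dt \right)\right]^{\frac{1}{\alpha}},\qquad x\in(0,+\infty).$$ (ii) Let $a\in(0,+\infty)$ and let $\breve L$ be a function on $(0,+\infty)$, measurable and such that $t\mapsto \breve L(t)/t$ is integrable on every compact subinterval of $(0,+\infty)$, satisfying: (1) $0\le \breve L(x)<+\infty$ for all $x\in(0,+\infty)$; (2) $\lim_{x\to0^+}\int_x^a \frac{\breve L(t)}{t}\,\mathrm dt<+\infty$; (3) $\lim_{x\to+\infty}\int_a^x \frac{\breve L(t)}{t}\,\mathrm dt=+\infty$. Then $\breve L$ determines a unique absolutely continuous distribution function $F$ by the relationship $$F(x)=1-W_\alpha\left(\frac1\alpha\exp\left(-\int_0^x \frac{\breve L(t)}{t}\,\mathrm dt\right)\right)=\left[1-\exp\left(-\int_0^x \frac{\breve L(t)}{t}\,\mathrm dt \right)\right]^{\frac{1}{\alpha}},\qquad x\in(0,+\infty),$$ and $\breve L$ is the $\alpha$-generalized reversed aging intensity function of that distribution function.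
   Context: Random variables are real-valued, non-negative and absolutely continuous with cdf $F$ and density $f$, with $F(x)<1$ for all $x\in(0,+\infty)$. For $\alpha\neq0$ the $\alpha$-generalized reversed aging intensity function of such a variable (or of its distribution function) is $$\breve L_\alpha(x)=\frac{\alpha x F^{\alpha-1}(x) f(x)}{1-F^\alpha(x)},\qquad x>0,$$ where for $\alpha>0$ the product $F^{\alpha-1}(x)f(x)$ (which is $\frac1\alpha\frac{\mathrm d}{\mathrm dx}F^\alpha(x)$) is taken to be $0$ at points with $F(x)=0$. Since densities are determined only up to Lebesgue-null sets, a function being "the" $\alpha$-generalized reversed aging intensity function of $F$ is understood for almost every $x\in(0,+\infty)$. $F^\alpha(x)$ means $(F(x))^\alpha$. For $\alpha>0$, $W_\alpha$ is the generalized Pareto distribution function $W_\alpha(x)=1-(1-\alpha x)^{1/\alpha}$ for $0<x<\frac1\alpha$, extended by $W_\alpha(x)=1$ for $x\geq \frac1\alpha$. The distribution function $F$ in (ii) is that of a non-negative random variable, i.e. $F(x)=0$ for $x\le0$. *)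

theory Defs
  imports "HOL-Probability.Probability"
begin

definition cdf_has_density :: "(real \<Rightarrow> real) \<Rightarrow> (real \<Rightarrow> real) \<Rightarrow> bool" where
  "cdf_has_density F f \<longleftrightarrow>
     f \<in> borel_measurable borel \<and> (\<forall>x. 0 \<le> f x) \<and>
     prob_space (density lborel (\<lambda>x. ennreal (f x))) \<and>
     F = cdf (density lborel (\<lambda>x. ennreal (f x)))"

definition ac_cdf :: "(real \<Rightarrow> real) \<Rightarrow> bool" where
  "ac_cdf F \<longleftrightarrow> (\<exists>f. cdf_has_density F f)"

(* Since 0 powr b = 0 for every b (also b = 0), the numerator vanishes wherever F x = 0,
   which is the convention intended for alpha > 0. *)
definition gra_intensity :: "real \<Rightarrow> (real \<Rightarrow> real) \<Rightarrow> (real \<Rightarrow> real) \<Rightarrow> real \<Rightarrow> real" where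
  "gra_intensity \<alpha> F f x = \<alpha> * x * (F x powr (\<alpha> - 1)) * f x / (1 - F x powr \<alpha>)"

(* Densities, hence generalized reversed aging intensities, are determined up to null sets:
   L is the intensity of F if it agrees with the formula almost everywhere on the positive
   half-line, for some (equivalently, every) density of F. Values of L elsewhere are
   irrelevant. The AE is over the complete measure, so L need not be Borel measurable. *)
definition is_gra_intensity :: "real \<Rightarrow> (real \<Rightarrow> real) \<Rightarrow> (real \<Rightarrow> real) \<Rightarrow> bool" where
  "is_gra_intensity \<alpha> F L \<longleftrightarrow>
     (\<exists>f. cdf_has_density F f \<and>
          (AE x in lebesgue. x > 0 \<longrightarrow> L x = gra_intensity \<alpha> F f x))"

(* The generalized Pareto distribution function, for alpha > 0 only. *)
definition gen_pareto_cdf :: "real \<Rightarrow> real \<Rightarrow> real" where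
  "gen_pareto_cdf \<alpha> x =
     (if x \<le> 0 then 0
      else if x < 1 / \<alpha> then 1 - (1 - \<alpha> * x) powr (1 / \<alpha>)
      else 1)"

end

theory Submission imports Defs
begin

text \<open>
Write \<open>I x\<close> for the integral of \<open>L t / t\<close> over \<open>{0<..x}\<close>. Formally, if \<open>L\<close> is the intensity of
\<open>F\<close> then \<open>L t / t\<close> is the derivative of \<open>- ln (1 - F t powr \<alpha>)\<close>, so integration gives
\<open>I x = - ln (1 - F x powr \<alpha>)\<close>, which is the asserted formula. Conversely, differentiating
\<open>F x = (1 - exp (- I x)) powr (1 / \<alpha>)\<close> gives a density whose intensity is \<open>L\<close>. Uniqueness is
clear, since \<open>F\<close> vanishes on \<open>{..0}\<close> and the relation prescribes its other values.

Both directions need the chain rule for \<open>H \<circ> G\<close> where \<open>G\<close> is merely the integral of a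
nonnegative function \<open>g\<close>, hence differentiable only almost everywhere, and where \<open>H\<close> need not be
differentiable at \<open>0\<close>. Instead of the differentiation theory of absolutely continuous functions,
the proof uses a change of measure: the image under \<open>G\<close> of the measure with density \<open>g\<close> is
Lebesgue measure (\<open>nn_integral_substitution_indefinite\<close>). The integral of \<open>h (G s) * g s\<close> thus
equals that of \<open>h\<close> over \<open>[0, G b]\<close>, and the ordinary fundamental theorem of calculus applies to
\<open>H\<close> (\<open>nn_integral_chain_rule_indefinite\<close>). With \<open>G = F\<close> this gives the inversion formula
(\<open>gra_intensity_inversion\<close>), and with \<open>G = I\<close> the existence of the density
(\<open>gra_intensity_realization\<close>). The substitution formula for the indicator of \<open>{0}\<close> moreover shows
that \<open>L\<close> vanishes almost everywhere on the set where \<open>I = 0\<close>; there \<open>F\<close> is \<open>0\<close>, and so is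
the intensity of \<open>F\<close>.
\<close>

section \<open>Integrals along an indefinite integral\<close>

text \<open>
An indefinite integral written with the nonnegative integral is also an indefinite
Henstock--Kurzweil integral, and those are continuous.
\<close>

lemma continuous_on_indefinite_nn_integral:
  fixes g G :: "real \<Rightarrow> real"
  assumes [measurable]: "g \<in> borel_measurable borel" and g0: "\<And>s. 0 \<le> g s"
    and G0: "\<And>t. t \<in> {a..b} \<Longrightarrow> 0 \<le> G t"
    and G: "\<And>t. t \<in> {a..b} \<Longrightarrow> (\<integral>\<^sup>+s\<in>{a..t}. ennreal (g s) \<partial>lborel) = ennreal (G t)"
  shows "continuous_on {a..b} G"
proof (cases "a \<le> b")
  case True
  have eq: "integral {a..t} g = G t" if "t \<in> {a..b}" for t
  proof -
    have "(\<integral>\<^sup>+s\<in>{a..t}. ennreal (g s) \<partial>lborel) = ennreal (integral {a..t} g)"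
      using G[OF that] g0
      by (intro set_nn_integral_lborel_eq_integral) (auto simp: set_borel_measurable_def)
    then show ?thesis
      using G[OF that] G0[OF that] integral_nonneg
      by (metis ennreal_inj g0 integral_nonneg not_integrable_integral order_refl)
  qed
  have "(\<lambda>s. indicator {a..b} s * g s) integrable_on UNIV"
    using G[of b] True g0
    by (intro nn_integral_integrable_on) (auto simp: ennreal_mult' ennreal_indicator mult.commute)
  then have "g integrable_on {a..b}"
    using integrable_restrict_UNIV[of "{a..b}" g]
    by (simp add: indicator_def of_bool_def if_distrib if_distribR cong: if_cong)
  then have "continuous_on {a..b} (\<lambda>t. integral {a..t} g)"
    by (rule indefinite_integral_continuous_1)
  then show ?thesis
    by (rule continuous_on_eq) (rule eq)
qed simp

text \<open>
The image under \<open>G\<close> of the measure with density \<open>g\<close> on \<open>[a, b]\<close> is Lebesgue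
measure on \<open>[0, G b]\<close>. For a distribution function this is the probability integral
transform: \<open>F(X)\<close> is uniformly distributed when \<open>F\<close> is continuous. It suffices to compare
the two measures on half-lines \<open>{u<..}\<close>. For \<open>0 \<le> u < G b\<close> let \<open>s1\<close> be the last point with
\<open>G s1 \<le> u\<close>; then \<open>G s1 = u\<close> by continuity, the set where \<open>G > u\<close> is \<open>{s1<..b}\<close>, and
it has mass \<open>G b - u\<close>.
\<close>

lemma nn_integral_substitution_indefinite:
  fixes g G :: "real \<Rightarrow> real" and h :: "real \<Rightarrow> ennreal"
  assumes [measurable]: "g \<in> borel_measurable borel" and g0: "\<And>s. 0 \<le> g s"
    and G0: "\<And>t. t \<in> {a..b} \<Longrightarrow> 0 \<le> G t"
    and G: "\<And>t. t \<in> {a..b} \<Longrightarrow> (\<integral>\<^sup>+s\<in>{a..t}. ennreal (g s) \<partial>lborel) = ennreal (G t)"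
    and [measurable]: "h \<in> borel_measurable borel" and ab: "a \<le> b"
  shows "(\<integral>\<^sup>+s\<in>{a..b}. h (G s) * ennreal (g s) \<partial>lborel) = (\<integral>\<^sup>+u\<in>{0..G b}. h u \<partial>lborel)"
proof -
  have cont: "continuous_on {a..b} G"
    by (rule continuous_on_indefinite_nn_integral[OF assms(1-4)])
  define G' where "G' s = indicator {a..b} s *\<^sub>R G s" for s
  have [measurable]: "G' \<in> borel_measurable borel"
    unfolding G'_def by (intro borel_measurable_continuous_on_indicator cont) auto
  define N where "N = density lborel (\<lambda>s. ennreal (g s) * indicator {a..b} s)"
  have setsN[measurable_cong]: "sets N = sets borel" by (simp add: N_def)
  have space_N [simp]: "space N = UNIV" by (simp add: N_def)
  have N: "emeasure N A = (\<integral>\<^sup>+s\<in>A \<inter> {a..b}. ennreal (g s) \<partial>lborel)" if "A \<in> sets borel" for A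
    using that by (auto simp: N_def emeasure_density indicator_def intro!: nn_integral_cong)
  have Ga: "G a = 0"
  proof -
    have "emeasure N {a} = 0"
    proof -
      have "AE s in lborel. s \<noteq> a" by (rule AE_lborel_singleton)
      then show ?thesis
        by (subst N) (auto simp: nn_integral_0_iff_AE elim: eventually_mono)
    qed
    moreover have "emeasure N {a} = ennreal (G a)"
      using ab G[of a] by (subst N) auto
    ultimately show ?thesis using G0[of a] ab by (simp add: ennreal_eq_0_iff)
  qed
  have Gmono: "G s \<le> G t" if "s \<in> {a..b}" "t \<in> {a..b}" "s \<le> t" for s t
  proof -
    have "ennreal (G s) \<le> ennreal (G t)"
      using that by (subst (1 2) G[symmetric]) (auto intro!: nn_integral_mono simp: indicator_def)
    then show ?thesis using G0[OF that(2)] by (simp add: ennreal_le_iff)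
  qed
  have "distr N borel G' = density lborel (indicator {0..G b})" (is "?K = ?U")
  proof (rule measure_eqI_lessThan)
    have [measurable]: "G' -` {u<..} \<in> sets borel" for u
      by (intro measurable_sets_borel[of G' borel]) auto
    have fin: "emeasure ?K {u<..} < \<infinity>"  for u
    proof -
      have "emeasure ?K {u<..} \<le> emeasure N {a..b}"
        by (subst emeasure_distr) (auto simp: N indicator_def intro!: nn_integral_mono)
      also have "\<dots> < \<infinity>" using G[of b] ab by (simp add: N)
      finally show ?thesis .
    qed
    show "emeasure ?K {u<..} < \<infinity>" for u by (rule fin)
    fix u :: real
    have K: "emeasure ?K {u<..} = (\<integral>\<^sup>+s\<in>{s\<in>{a..b}. u < G s}. ennreal (g s) \<partial>lborel)"
      by (subst emeasure_distr)
         (auto simp: N space_N indicator_def G'_def intro!: nn_integral_cong)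
    have U: "emeasure ?U {u<..} = emeasure lborel ({0..G b} \<inter> {u<..})"
      by (simp add: emeasure_density flip: indicator_inter_arith)
    consider "u < 0" | "0 \<le> u" "u < G b" | "G b \<le> u" by linarith
    then show "emeasure ?K {u<..} = emeasure ?U {u<..}"
    proof cases
      case 1
      have e1: "{s\<in>{a..b}. u < G s} = {a..b}" using G0 1 by force
      have e2: "{0..G b} \<inter> {u<..} = {0..G b}" using 1 by auto
      show ?thesis unfolding K U e1 e2 using K U G[of b] G0[of b] ab by simp
    next
      case 3
      then have e1: "{s\<in>{a..b}. u < G s} = {}" using Gmono[of _ b] ab by force
      have e2: "{0..G b} \<inter> {u<..} = {}" using 3 by auto
      show ?thesis unfolding K U e1 e2 by simp
    next
      case 2
      have "closed {s\<in>{a..b}. G s \<le> u}"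
        using continuous_closed_preimage[OF cont closed_atLeastAtMost closed_atMost[of u]]
        by (simp add: vimage_def Int_def)
      then have "compact {s\<in>{a..b}. G s \<le> u}"
        unfolding compact_eq_bounded_closed
        by (intro conjI bounded_subset[OF bounded_closed_interval[of a b]]) auto
      moreover have "{s\<in>{a..b}. G s \<le> u} \<noteq> {}"
        using Ga 2 ab by auto
      ultimately obtain s1 where s1: "s1 \<in> {a..b}" "G s1 \<le> u" 
        and max: "\<And>s. s \<in> {a..b} \<Longrightarrow> G s \<le> u \<Longrightarrow> s \<le> s1"
        using compact_attains_sup[of "{s\<in>{a..b}. G s \<le> u}"] by blast
      have "G s1 = u"
      proof -
        obtain s where s: "s1 \<le> s" "s \<le> b" "G s = u"
          using IVT'[of G s1 u b] s1 2 continuous_on_subset[OF cont, of "{s1..b}"] by auto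
        then have "s = s1" using max[of s] s1 by auto
        then show ?thesis using s by simp
      qed
      have e1: "{s\<in>{a..b}. u < G s} = {s1<..b}"
      proof (intro set_eqI iffI)
        fix s assume "s \<in> {s\<in>{a..b}. u < G s}"
        then show "s \<in> {s1<..b}" using Gmono[of s s1] s1 by (cases "s \<le> s1") auto
      next
        fix s assume "s \<in> {s1<..b}"
        then show "s \<in> {s\<in>{a..b}. u < G s}" using max[of s] s1 by (cases "G s \<le> u") auto
      qed
      have e2: "{0..G b} \<inter> {u<..} = {u<..G b}" using 2 by auto
      have "ennreal u + (\<integral>\<^sup>+s\<in>{s1<..b}. ennreal (g s) \<partial>lborel)
          = (\<integral>\<^sup>+s\<in>{a..s1}. ennreal (g s) \<partial>lborel) + (\<integral>\<^sup>+s\<in>{s1<..b}. ennreal (g s) \<partial>lborel)"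
        using G[OF s1(1)] \<open>G s1 = u\<close> by simp
      also have "\<dots> = (\<integral>\<^sup>+s\<in>{a..b}. ennreal (g s) \<partial>lborel)"
        using s1 by (subst nn_integral_add[symmetric]) (auto intro!: nn_integral_cong simp: indicator_def)
      also have "\<dots> = ennreal (G b)" using G[of b] ab by simp
      also have "\<dots> = ennreal u + ennreal (G b - u)"
        using 2 by (simp flip: ennreal_plus)
      finally have "(\<integral>\<^sup>+s\<in>{s1<..b}. ennreal (g s) \<partial>lborel) = ennreal (G b - u)"
        by (simp add: ennreal_add_left_cancel)
      then show ?thesis unfolding K U e1 e2 using 2 by simp
    qed
  qed auto
  then have "(\<integral>\<^sup>+u. h u \<partial>?K) = (\<integral>\<^sup>+u. h u \<partial>?U)" by simp
  also have "(\<integral>\<^sup>+u. h u \<partial>?K) = (\<integral>\<^sup>+s. h (G' s) \<partial>N)"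
    by (rule nn_integral_distr) (auto simp: N_def)
  also have "\<dots> = (\<integral>\<^sup>+s. (ennreal (g s) * indicator {a..b} s) * h (G' s) \<partial>lborel)"
    unfolding N_def by (rule nn_integral_density) measurable
  also have "\<dots> = (\<integral>\<^sup>+s\<in>{a..b}. h (G s) * ennreal (g s) \<partial>lborel)"
    by (intro nn_integral_cong) (auto simp: G'_def indicator_def mult.commute)
  also have "(\<integral>\<^sup>+u. h u \<partial>?U) = (\<integral>\<^sup>+u\<in>{0..G b}. h u \<partial>lborel)"
    by (subst nn_integral_density) (auto simp: mult.commute)
  finally show ?thesis .
qed

text \<open>
The chain rule \<open>(H \<circ> G)' = (h \<circ> G) * g\<close> in integrated form. Since the derivative of \<open>H\<close>
is only asked for in the open interval, \<open>H\<close> may have a vertical tangent at \<open>0\<close>, as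
\<open>u powr c\<close> has for \<open>c < 1\<close>.
\<close>

lemma nn_integral_chain_rule_indefinite:
  fixes g G H h :: "real \<Rightarrow> real"
  assumes "g \<in> borel_measurable borel" and "\<And>s. 0 \<le> g s"
    and "\<And>t. t \<in> {a..b} \<Longrightarrow> 0 \<le> G t"
    and "\<And>t. t \<in> {a..b} \<Longrightarrow> (\<integral>\<^sup>+s\<in>{a..t}. ennreal (g s) \<partial>lborel) = ennreal (G t)"
    and [measurable]: "h \<in> borel_measurable borel" and "a \<le> b"
    and h0: "\<And>u. u \<in> {0..G b} \<Longrightarrow> 0 \<le> h u"
    and H: "continuous_on {0..G b} H"
    and deriv: "\<And>u. 0 < u \<Longrightarrow> u < G b \<Longrightarrow> (H has_real_derivative h u) (at u)"
  shows "(\<integral>\<^sup>+s\<in>{a..b}. ennreal (h (G s)) * ennreal (g s) \<partial>lborel) = ennreal (H (G b) - H 0)"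
proof -
  have "(\<integral>\<^sup>+s\<in>{a..b}. ennreal (h (G s)) * ennreal (g s) \<partial>lborel)
      = (\<integral>\<^sup>+u\<in>{0..G b}. ennreal (h u) \<partial>lborel)"
    using assms(1-4,6) by (intro nn_integral_substitution_indefinite) auto
  also have "\<dots> = ennreal (H (G b) - H 0)"
  proof (rule nn_integral_has_integral_lebesgue'[OF h0])
    show "(h has_integral H (G b) - H 0) {0..G b}"
      using assms(3)[of b] assms(6) deriv
      by (intro fundamental_theorem_of_calculus_interior H)
         (auto simp: has_real_derivative_iff_has_vector_derivative)
  qed
  finally show ?thesis .
qed

text \<open>
Passage from the Borel world, in which nonnegative integrals are computed, to integrals over
the completed measure of a function that is known only almost everywhere.
\<close>

lemma absolutely_integrable_set_integral_from_nn_integral: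
  fixes k g :: "real \<Rightarrow> real"
  assumes [measurable]: "g \<in> borel_measurable borel" "S \<in> sets borel" and g0: "\<And>s. 0 \<le> g s"
    and ae: "AE s in lborel. s \<in> S \<longrightarrow> k s = g s"
    and int: "(\<integral>\<^sup>+s\<in>S. ennreal (g s) \<partial>lborel) = ennreal r" and r: "0 \<le> r"
  shows "k absolutely_integrable_on S" "(LINT s:S|lebesgue. k s) = r"
proof -
  let ?g = "\<lambda>s. indicator S s *\<^sub>R g s" and ?k = "\<lambda>s. indicator S s *\<^sub>R k s"
  have [measurable]: "?g \<in> borel_measurable borel" by measurable
  have gm: "?g \<in> borel_measurable lebesgue" by (rule measurable_completion) simp
  have eq: "AE s in lebesgue. ?g s = ?k s"
    unfolding AE_completion_iff using ae by eventually_elim (auto simp: indicator_def)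
  have km: "?k \<in> borel_measurable lebesgue"
    by (rule borel_measurable_AE[OF gm eq])
  have nn: "(\<integral>\<^sup>+s. ennreal (?g s) \<partial>lborel) = ennreal r"
    unfolding int[symmetric] by (intro nn_integral_cong) (auto simp: indicator_def)
  have ig: "integrable lborel ?g"
    using g0 nn by (intro integrableI_nonneg) auto
  have "integral\<^sup>L lborel ?g = r"
    using g0 r nn by (subst integral_eq_nn_integral) auto
  then have Lg: "integral\<^sup>L lebesgue ?g = r" by (simp add: integral_completion)
  have "integrable lebesgue ?g" using ig by (simp add: integrable_completion)
  then show "k absolutely_integrable_on S"
    unfolding set_integrable_def using eq gm km integrable_cong_AE by blast
  show "(LINT s:S|lebesgue. k s) = r"
    unfolding set_lebesgue_integral_def using Lg eq gm km integral_cong_AE by metis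
qed

section \<open>Recovering a distribution function from its intensity\<close>

lemma nn_integral_atMost_cdf_has_density:
  assumes "cdf_has_density F f"
  shows "(\<integral>\<^sup>+s\<in>{..x}. ennreal (f s) \<partial>lborel) = ennreal (F x)"
proof -
  have [measurable]: "f \<in> borel_measurable borel"
    and p: "prob_space (density lborel (\<lambda>x. ennreal (f x)))"
    and F: "F = cdf (density lborel (\<lambda>x. ennreal (f x)))"
    using assms by (auto simp: cdf_has_density_def)
  interpret prob_space "density lborel (\<lambda>x. ennreal (f x))" by (rule p)
  show ?thesis
    by (simp add: F cdf_def emeasure_eq_measure[symmetric] emeasure_density)
qed

lemma cdf_has_densityI:
  assumes [measurable]: "f \<in> borel_measurable borel" and f0: "\<And>x. 0 \<le> f x"
    and F0: "\<And>x. 0 \<le> F x"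
    and F: "\<And>x. (\<integral>\<^sup>+s\<in>{..x}. ennreal (f s) \<partial>lborel) = ennreal (F x)"
    and lim: "(F \<longlongrightarrow> 1) at_top"
  shows "cdf_has_density F f"
proof -
  let ?N = "density lborel (\<lambda>x. ennreal (f x))"
  have N: "emeasure ?N {..x} = ennreal (F x)" for x
    using F by (simp add: emeasure_density)
  have "(\<lambda>n. emeasure ?N {..real n}) \<longlonglongrightarrow> emeasure ?N (\<Union>n. {..real n})"
    by (intro Lim_emeasure_incseq) (auto simp: incseq_def)
  moreover have "(\<Union>n. {..real n}) = UNIV"
    using real_arch_simple by auto
  moreover have "(\<lambda>n. ennreal (F (real n))) \<longlonglongrightarrow> ennreal 1"
    by (intro tendsto_ennrealI filterlim_compose[OF lim] filterlim_real_sequentially)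
  ultimately have "emeasure ?N (space ?N) = 1"
    using LIMSEQ_unique by (fastforce simp: N)
  then have p: "prob_space ?N" by (rule prob_spaceI)
  have "F = cdf ?N"
    by (rule ext) (simp add: cdf_def measure_def N F0)
  with p f0 show ?thesis by (simp add: cdf_has_density_def)
qed

text \<open>
Almost everywhere \<open>L t / t = h (F t) * f t\<close>, where
\<open>h u = \<alpha> * u powr (\<alpha> - 1) / (1 - u powr \<alpha>)\<close> is the derivative of \<open>H u = - ln (1 - u powr \<alpha>)\<close>.
As \<open>F x < 1\<close>, the function \<open>H\<close> is continuous on \<open>[0, F x]\<close>, so the chain rule gives
\<open>- ln (1 - F x powr \<alpha>)\<close> for the integral of \<open>L t / t\<close> over \<open>{0<..x}\<close>, and this is solved
for \<open>F x\<close>.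
\<close>

lemma gra_intensity_inversion:
  fixes \<alpha> :: real
  assumes \<alpha>: "0 < \<alpha>" and d: "cdf_has_density F f"
    and neg: "AE s in lborel. s < 0 \<longrightarrow> f s = 0"
    and F1: "\<And>x. 0 < x \<Longrightarrow> F x < 1"
    and L: "AE x in lborel. x > 0 \<longrightarrow> L x = gra_intensity \<alpha> F f x"
    and x: "0 < x"
  shows "(\<lambda>t. L t / t) absolutely_integrable_on {0<..x} \<and>
    F x = (1 - exp (- (LINT t:{0<..x}|lebesgue. L t / t))) powr (1 / \<alpha>)"
proof -
  have [measurable]: "f \<in> borel_measurable borel" and f0: "\<And>s. 0 \<le> f s"
    using d by (auto simp: cdf_has_density_def)
  have F0: "0 \<le> F t" for t using d by (auto simp: cdf_has_density_def cdf_def)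
  have F: "(\<integral>\<^sup>+s\<in>{0..t}. ennreal (f s) \<partial>lborel) = ennreal (F t)" for t
  proof -
    have "(\<integral>\<^sup>+s\<in>{0..t}. ennreal (f s) \<partial>lborel) = (\<integral>\<^sup>+s\<in>{..t}. ennreal (f s) \<partial>lborel)"
      using neg by (intro nn_integral_cong_AE) (auto elim!: eventually_mono simp: indicator_def)
    then show ?thesis using nn_integral_atMost_cdf_has_density[OF d] by simp
  qed
  have Fmono: "F s \<le> F t" if "s \<le> t" for s t
  proof -
    have "ennreal (F s) \<le> ennreal (F t)"
      using that by (subst (1 2) F[symmetric]) (auto intro!: nn_integral_mono simp: indicator_def)
    then show ?thesis using F0 by simp
  qed
  have [measurable]: "F \<in> borel_measurable borel"
    by (rule borel_measurable_mono) (auto simp: mono_def Fmono)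
  define h where "h u = \<alpha> * u powr (\<alpha> - 1) / (1 - u powr \<alpha>)" for u
  define H where "H u = - ln (1 - u powr \<alpha>)" for u
  have lt1: "u powr \<alpha> < 1" if "0 \<le> u" "u < 1" for u
    using that \<alpha> powr_less_mono2[of \<alpha> u 1] by simp
  have [measurable]: "h \<in> borel_measurable borel" unfolding h_def by measurable
  have h0: "0 \<le> h u" if "0 \<le> u" "u < 1" for u
    using lt1[OF that] that \<alpha> by (simp add: h_def)
  have "F x < 1" using F1 x by simp
  have nn: "(\<integral>\<^sup>+s\<in>{0..x}. ennreal (h (F s)) * ennreal (f s) \<partial>lborel) = ennreal (H (F x) - H 0)"
  proof (rule nn_integral_chain_rule_indefinite)
    show "continuous_on {0..F x} H"
      unfolding H_def using lt1 \<open>F x < 1\<close> \<alpha>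
      by (intro continuous_intros continuous_on_powr') force+
    fix u assume u: "0 < u" "u < F x"
    show "(H has_real_derivative h u) (at u)"
      unfolding H_def h_def using lt1[of u] \<open>F x < 1\<close> u
      by (auto intro!: derivative_eq_intros simp: field_simps)
  qed (use F F0 f0 h0 \<open>F x < 1\<close> x in auto)
  have H0: "H 0 = 0" using \<alpha> by (simp add: H_def)
  have HF: "0 \<le> H (F x)" using lt1[of "F x"] F0[of x] \<open>F x < 1\<close> by (simp add: H_def)
  have hF0: "0 \<le> h (F s)" for s
    using F0[of s] F1[of "max s 1"] Fmono[of s "max s 1"] by (intro h0) linarith+
  let ?g = "\<lambda>s. h (F s) * f s"
  have int: "(\<integral>\<^sup>+s\<in>{0<..x}. ennreal (?g s) \<partial>lborel) = ennreal (H (F x))"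
  proof -
    have "AE s in lborel. s \<noteq> (0::real)" by (rule AE_lborel_singleton)
    then have "(\<integral>\<^sup>+s\<in>{0<..x}. ennreal (?g s) \<partial>lborel)
      = (\<integral>\<^sup>+s\<in>{0..x}. ennreal (h (F s)) * ennreal (f s) \<partial>lborel)"
      by (intro nn_integral_cong_AE, eventually_elim) (auto simp: indicator_def ennreal_mult' hF0)
    then show ?thesis using nn H0 by simp
  qed
  have ae: "AE s in lborel. s \<in> {0<..x} \<longrightarrow> L s / s = ?g s"
    using L by eventually_elim (auto simp: gra_intensity_def h_def)
  note * = absolutely_integrable_set_integral_from_nn_integral[OF _ _ _ ae int HF]
  have "(\<lambda>t. L t / t) absolutely_integrable_on {0<..x}" by (rule *) (auto simp: hF0 f0)
  moreover have "(LINT t:{0<..x}|lebesgue. L t / t) = H (F x)" by (rule *) (auto simp: hF0 f0)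
  moreover have "exp (- H (F x)) = 1 - F x powr \<alpha>"
    using lt1[of "F x"] F0[of x] \<open>F x < 1\<close> by (simp add: H_def)
  ultimately show ?thesis
    using \<alpha> F0[of x] by (simp add: powr_powr)
qed

text \<open>
The intensity refers to a density of \<open>F\<close>, not of \<open>X\<close>. Both give the same law because a
distribution function determines its measure, and so the sign condition on \<open>X\<close>
restricts the density.
\<close>

lemma density_zero_on_negatives:
  assumes M: "prob_space M" and X: "X \<in> borel_measurable M" and nonneg: "AE \<omega> in M. 0 \<le> X \<omega>"
    and d: "cdf_has_density (cdf (distr M borel X)) f"
  shows "AE s in lborel. s < 0 \<longrightarrow> f s = 0"
proof -
  have [measurable]: "f \<in> borel_measurable borel" and f0: "\<And>s. 0 \<le> f s"
    using d by (auto simp: cdf_has_density_def)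
  have "distr M borel X = density lborel (\<lambda>x. ennreal (f x))"
    using d M X by (intro cdf_unique prob_space.real_distribution_distr)
      (auto simp: cdf_has_density_def real_distribution_def real_distribution_axioms_def)
  moreover have "AE s in distr M borel X. 0 \<le> s"
    using nonneg X by (subst AE_distr_iff) auto
  ultimately have "AE s in density lborel (\<lambda>x. ennreal (f x)). 0 \<le> s" by metis
  then have "AE s in lborel. 0 < ennreal (f s) \<longrightarrow> 0 \<le> s"
    by (subst (asm) AE_density) auto
  then show ?thesis
    by eventually_elim (use f0 in \<open>force simp: less_le\<close>)
qed

section \<open>Constructing a distribution function with a given intensity\<close>

text \<open>
At \<open>u = 0\<close> the argument is exactly the right end point \<open>1 / \<alpha>\<close> of the Pareto support.
\<close>

lemma gen_pareto_cdf_exp: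
  assumes "0 < \<alpha>" "0 \<le> u"
  shows "1 - gen_pareto_cdf \<alpha> (1 / \<alpha> * exp (- u)) = (1 - exp (- u)) powr (1 / \<alpha>)"
  using assms by (cases "u = 0") (auto simp: gen_pareto_cdf_def field_simps)

lemma ex_borel_density:
  fixes k :: "real \<Rightarrow> real"
  assumes k: "k \<in> borel_measurable (lebesgue_on {0<..})" and k0: "\<And>t. 0 < t \<Longrightarrow> 0 \<le> k t"
  obtains g where "g \<in> borel_measurable borel" "\<And>t. 0 \<le> g t" "\<And>t. t \<le> 0 \<Longrightarrow> g t = 0"
    "AE t in lborel. 0 < t \<longrightarrow> k t = g t"
proof -
  have "(\<lambda>t. if t \<in> {0<..} then k t else 0) \<in> borel_measurable lebesgue"
    using k by (subst borel_measurable_if) auto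
  then obtain g where [measurable]: "g \<in> borel_measurable borel"
    and g: "AE t in lborel. (if t \<in> {0<..} then k t else 0) = g t"
    using completion_ex_borel_measurable_real[of _ lborel] by auto
  show thesis
  proof (rule that[of "\<lambda>t. indicator {0<..} t * max 0 (g t)"])
    show "AE t in lborel. 0 < t \<longrightarrow> k t = indicator {0<..} t * max 0 (g t)"
      using g
    proof eventually_elim
      case (elim t)
      then show ?case using k0[of t] by (cases "0 < t") auto
    qed
  qed (auto simp: indicator_def)
qed

text \<open>
The masses \<open>J x\<close> of \<open>{x..a}\<close> increase as \<open>x\<close> decreases to \<open>0\<close>, so their limit bounds them all, and
\<open>{0<..a}\<close> is exhausted by the intervals \<open>{a / (n + 1)..a}\<close>.
\<close>

lemma emeasure_Ioc_finite_if_tail_integrals_converge: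
  fixes N :: "real measure"
  assumes sets: "sets N = sets borel" and a: "0 < a"
    and J: "\<And>x. 0 < x \<Longrightarrow> x \<le> a \<Longrightarrow> emeasure N {x..a} = ennreal (J x)"
    and J0: "\<And>x. 0 < x \<Longrightarrow> x \<le> a \<Longrightarrow> 0 \<le> J x"
    and l: "(J \<longlongrightarrow> l) (at_right (0::real))"
  shows "emeasure N {0<..a} < \<infinity>"
proof -
  have le: "J x \<le> l" if x: "0 < x" "x \<le> a" for x
  proof (rule tendsto_lowerbound[OF l])
    show "\<forall>\<^sub>F y in at_right 0. J x \<le> J y"
    proof -
      have "\<forall>\<^sub>F y in at_right 0. y \<in> {0<..<x}" using x by (intro eventually_at_right_real)
      then show ?thesis
      proof eventually_elim
        case (elim y)
        have "ennreal (J x) \<le> ennreal (J y)"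
          using elim x by (subst (1 2) J[symmetric]) (auto intro!: emeasure_mono simp: sets)
        then show ?case using J0[of y] elim x by (simp add: ennreal_le_iff)
      qed
    qed
  qed simp
  have "(\<Union>n. {a / Suc n..a}) = {0<..a}"
  proof (intro set_eqI iffI)
    fix t assume t: "t \<in> {0<..a}"
    then obtain n where "inverse (real (Suc n)) < t / a"
      using a reals_Archimedean[of "t / a"] by auto
    then have "a / Suc n \<le> t" using a by (simp add: field_simps)
    then show "t \<in> (\<Union>n. {a / Suc n..a})" using t by auto
  next
    fix t assume "t \<in> (\<Union>n. {a / Suc n..a})"
    then obtain n where n: "a / Suc n \<le> t" "t \<le> a" by auto
    have "0 < a / Suc n" using a by simp
    with n show "t \<in> {0<..a}" by (auto intro: less_le_trans)
  qed
  then have "emeasure N {0<..a} = (SUP n. emeasure N {a / Suc n..a})"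
    using a by (subst SUP_emeasure_incseq)
      (auto simp: sets incseq_def frac_le elim!: order_trans[rotated])
  also have "\<dots> \<le> ennreal l"
  proof (rule SUP_least)
    fix n
    have "0 < a / Suc n" "a / Suc n \<le> a" using a by (auto simp: field_simps)
    then show "emeasure N {a / Suc n..a} \<le> ennreal l"
      by (subst J) (auto intro!: ennreal_leI le)
  qed
  finally show ?thesis by (simp add: order_le_less_trans)
qed

text \<open>
Here \<open>G\<close> is the cumulative integral of \<open>L t / t\<close>, with Borel representative \<open>g\<close>, and
\<open>F = H \<circ> G\<close> with \<open>H u = (1 - exp (- u)) powr (1 / \<alpha>)\<close>. The chain rule shows that
\<open>h (G s) * g s\<close>, with \<open>h\<close> the derivative of \<open>H\<close>, is a density of \<open>F\<close>, and the total mass is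
\<open>1\<close> because \<open>G\<close> tends to infinity. Where \<open>G x > 0\<close>, inserting this density into the
formula for the intensity gives back \<open>x * g x\<close>. Where \<open>G x = 0\<close> the formula gives \<open>0\<close>, so
that \<open>g\<close> must be shown to vanish almost everywhere on that set.
\<close>

lemma gra_intensity_realization:
  fixes \<alpha> :: real
  assumes \<alpha>: "0 < \<alpha>"
    and gm [measurable]: "g \<in> borel_measurable borel" and g0: "\<And>s. 0 \<le> g s"
    and gneg: "\<And>s. s \<le> 0 \<Longrightarrow> g s = 0"
    and G0: "\<And>t. 0 \<le> G t"
    and G: "\<And>t. (\<integral>\<^sup>+s\<in>{0..t}. ennreal (g s) \<partial>lborel) = ennreal (G t)"
    and Glim: "filterlim G at_top at_top"
    and ae: "AE t in lborel. 0 < t \<longrightarrow> L t / t = g t"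
  defines "F \<equiv> \<lambda>x. (1 - exp (- G x)) powr (1 / \<alpha>)"
  obtains f where "cdf_has_density F f" "AE x in lborel. x > 0 \<longrightarrow> L x = gra_intensity \<alpha> F f x"
    "\<And>x. x \<le> 0 \<Longrightarrow> F x = 0"
proof -
  have Gmono: "G s \<le> G t" if "s \<le> t" for s t
  proof -
    have "ennreal (G s) \<le> ennreal (G t)"
      using that by (subst (1 2) G[symmetric]) (auto intro!: nn_integral_mono simp: indicator_def)
    then show ?thesis using G0 by simp
  qed
  have [measurable]: "G \<in> borel_measurable borel"
    by (rule borel_measurable_mono) (auto simp: mono_def Gmono)
  have Gneg: "G t = 0" if "t \<le> 0" for t
  proof -
    have "(\<integral>\<^sup>+s\<in>{0..t}. ennreal (g s) \<partial>lborel) = (\<integral>\<^sup>+s. 0 \<partial>(lborel :: real measure))"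
      using that gneg by (intro nn_integral_cong) (auto simp: indicator_def)
    then show ?thesis using G[of t] G0[of t] by (simp add: ennreal_eq_0_iff)
  qed
  define H where "H u = (1 - exp (- u)) powr (1 / \<alpha>)" for u :: real
  define h where "h u = 1 / \<alpha> * (1 - exp (- u)) powr (1 / \<alpha> - 1) * exp (- u)" for u :: real
  have FH: "F x = H (G x)" for x by (simp add: F_def H_def)
  have [measurable]: "h \<in> borel_measurable borel" unfolding h_def by measurable
  have h0: "0 \<le> h u" for u using \<alpha> by (simp add: h_def)
  have H0: "H 0 = 0" by (simp add: H_def)
  have Fneg: "F x = 0" if "x \<le> 0" for x using Gneg[OF that] by (simp add: FH H0)
  define f where "f s = h (G s) * g s" for s
  have [measurable]: "f \<in> borel_measurable borel" unfolding f_def by measurable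
  have f0: "0 \<le> f s" for s using h0 g0 by (simp add: f_def)
  have F0: "0 \<le> F x" for x by (simp add: F_def)
  have chain: "(\<integral>\<^sup>+s\<in>{0..x}. ennreal (f s) \<partial>lborel) = ennreal (F x)" if x: "0 \<le> x" for x
  proof -
    have "(\<integral>\<^sup>+s\<in>{0..x}. ennreal (h (G s)) * ennreal (g s) \<partial>lborel) = ennreal (H (G x) - H 0)"
    proof (rule nn_integral_chain_rule_indefinite)
      show "continuous_on {0..G x} H"
        unfolding H_def using \<alpha>
        by (intro continuous_on_powr' continuous_intros) auto
      fix u assume u: "0 < u" "u < G x"
      then show "(H has_real_derivative h u) (at u)"
        unfolding H_def h_def
        by (auto intro!: derivative_eq_intros simp: powr_diff field_simps)
    qed (use G0 G g0 h0 x in auto)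
    then show ?thesis using h0 g0 by (simp add: FH H0 f_def ennreal_mult)
  qed
  have "cdf_has_density F f"
  proof (rule cdf_has_densityI)
    fix x
    show "(\<integral>\<^sup>+s\<in>{..x}. ennreal (f s) \<partial>lborel) = ennreal (F x)"
    proof (cases "0 \<le> x")
      case True
      have "(\<integral>\<^sup>+s\<in>{..x}. ennreal (f s) \<partial>lborel) = (\<integral>\<^sup>+s\<in>{0..x}. ennreal (f s) \<partial>lborel)"
        using gneg by (intro nn_integral_cong) (auto simp: indicator_def f_def)
      then show ?thesis using chain[OF True] by simp
    next
      case False
      have "(\<integral>\<^sup>+s\<in>{..x}. ennreal (f s) \<partial>lborel) = (\<integral>\<^sup>+s. 0 \<partial>(lborel :: real measure))"
        using False gneg by (intro nn_integral_cong) (auto simp: indicator_def f_def)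
      then show ?thesis using Fneg False by simp
    qed
  next
    have "((\<lambda>x. (1 - exp (- G x)) powr (1 / \<alpha>)) \<longlongrightarrow> (1 - 0) powr (1 / \<alpha>)) at_top"
      by (intro tendsto_intros filterlim_compose[OF exp_at_bot] filterlim_compose[OF filterlim_uminus_at_bot_at_top] Glim) auto
    then show "(F \<longlongrightarrow> 1) at_top" by (simp add: F_def)
  qed (auto intro: f0 F0)
  moreover
  \<comment> \<open>Substitution with the indicator of \<open>{0}\<close>: the set where \<open>G = 0\<close> has the mass of a
    single point under Lebesgue measure.\<close>
  have "AE t in lborel. G t = 0 \<longrightarrow> g t = 0"
  proof -
    have "AE s in lborel. s \<in> {0..real n} \<longrightarrow> G s = 0 \<longrightarrow> g s = 0" for n
    proof -
      have "(\<integral>\<^sup>+s\<in>{0..real n}. indicator {0} (G s) * ennreal (g s) \<partial>lborel)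
          = (\<integral>\<^sup>+u\<in>{0..G (real n)}. indicator {0} u \<partial>lborel)"
        by (rule nn_integral_substitution_indefinite) (use G G0 g0 in auto)
      also have "\<dots> = 0"
        using AE_lborel_singleton[of "0::real"] by (subst nn_integral_0_iff_AE) (auto elim: eventually_mono)
      finally have "AE s in lborel. indicator {0} (G s) * ennreal (g s) * indicator {0..real n} s = 0"
        by (subst (asm) nn_integral_0_iff_AE) auto
      then show ?thesis
        by eventually_elim (use g0 in \<open>auto simp: indicator_def ennreal_eq_0_iff split: if_splits intro: antisym\<close>)
    qed
    then have "AE s in lborel. \<forall>n. s \<in> {0..real n} \<longrightarrow> G s = 0 \<longrightarrow> g s = 0"
      unfolding AE_all_countable by blast
    then show ?thesis
    proof eventually_elim
      case (elim s)
      obtain n where "s \<le> real n" using real_arch_simple by blast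
      then show ?case using elim gneg[of s] by (cases "0 \<le> s") auto
    qed
  qed
  with ae have "AE x in lborel. x > 0 \<longrightarrow> L x = gra_intensity \<alpha> F f x"
  proof eventually_elim
    case (elim x)
    show ?case
    proof
      assume x: "0 < x"
      then have L: "L x = x * g x" using elim by (simp add: field_simps)
      show "L x = gra_intensity \<alpha> F f x"
      proof (cases "G x = 0")
        case True
        then show ?thesis using elim L by (simp add: gra_intensity_def f_def)
      next
        case False
        define w where "w = 1 - exp (- G x)"
        have w: "0 < w" using False G0[of x] by (simp add: w_def)
        have e: "exp (- G x) = 1 - w" "0 < 1 - w" by (auto simp: w_def)
        have "F x = w powr (1 / \<alpha>)" by (simp add: F_def w_def)
        then have "F x powr \<alpha> = w" "F x powr (\<alpha> - 1) = w powr (1 - 1 / \<alpha>)"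
          using \<alpha> w by (simp_all add: powr_powr field_simps)
        moreover have "h (G x) = 1 / \<alpha> * w powr (1 / \<alpha> - 1) * (1 - w)"
          by (simp add: h_def w_def)
        ultimately have "gra_intensity \<alpha> F f x
          = x * (w powr (1 - 1 / \<alpha>) * w powr (1 / \<alpha> - 1)) * g x"
          using \<alpha> e(2) by (simp add: gra_intensity_def f_def)
        also have "w powr (1 - 1 / \<alpha>) * w powr (1 / \<alpha> - 1) = 1"
          using w by (simp flip: powr_add)
        finally show ?thesis using L by simp
      qed
    qed
  qed
  ultimately show thesis using that Fneg by blast
qed

text \<open>
The hypotheses on \<open>L\<close> say that \<open>L t / t\<close> has a finite cumulative integral from
\<open>0\<close> that tends to infinity. The function \<open>g\<close> is a Borel version of \<open>L t / t\<close>, as a density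
of a distribution function has to be Borel measurable. It is extended by \<open>0\<close> to
\<open>{..0}\<close>, as the law to be constructed from it lives on the positive half-line.
\<close>

lemma borel_density_of_cumulative_intensity:
  fixes L :: "real \<Rightarrow> real"
  assumes a: "0 < a" and Lm: "L \<in> borel_measurable (lebesgue_on {0<..})"
    and int: "\<And>c d. 0 < c \<Longrightarrow> c \<le> d \<Longrightarrow> (\<lambda>t. L t / t) absolutely_integrable_on {c..d}"
    and L0: "\<And>x. 0 < x \<Longrightarrow> 0 \<le> L x"
    and l: "((\<lambda>x. LINT t:{x..a}|lebesgue. L t / t) \<longlongrightarrow> l) (at_right 0)"
    and lim: "filterlim (\<lambda>x. LINT t:{a..x}|lebesgue. L t / t) at_top at_top"
  obtains g G where "g \<in> borel_measurable borel" "\<And>s. 0 \<le> g s" "\<And>s. s \<le> 0 \<Longrightarrow> g s = 0"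
    "\<And>t. 0 \<le> G t" "\<And>t. (\<integral>\<^sup>+s\<in>{0..t}. ennreal (g s) \<partial>lborel) = ennreal (G t)"
    "filterlim G at_top at_top" "AE t in lborel. 0 < t \<longrightarrow> L t / t = g t"
    "\<And>x. 0 < x \<Longrightarrow> (\<lambda>t. L t / t) absolutely_integrable_on {0<..x}"
    "\<And>x. 0 < x \<Longrightarrow> (LINT t:{0<..x}|lebesgue. L t / t) = G x"
proof -
  have "(\<lambda>t. L t / t) \<in> borel_measurable (lebesgue_on {0<..})"
    by (intro borel_measurable_divide Lm measurable_restrict_space1 measurable_completion) auto
  then obtain g where gm [measurable]: "g \<in> borel_measurable borel" and g0: "\<And>t. 0 \<le> g t"
    and gneg: "\<And>t. t \<le> 0 \<Longrightarrow> g t = 0" and ae: "AE t in lborel. 0 < t \<longrightarrow> L t / t = g t"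
    by (rule ex_borel_density) (use L0 in auto)
  define N where "N = density lborel (\<lambda>s. ennreal (g s))"
  have sets: "sets N = sets borel" by (simp add: N_def)
  have N: "emeasure N A = (\<integral>\<^sup>+s\<in>A. ennreal (g s) \<partial>lborel)" if "A \<in> sets borel" for A
    using that by (simp add: N_def emeasure_density)
  define J where "J c d = (LINT t:{c..d}|lebesgue. L t / t)" for c d
  have J: "0 \<le> J c d" "emeasure N {c..d} = ennreal (J c d)" if cd: "0 < c" "c \<le> d" for c d
  proof -
    let ?k = "\<lambda>t. indicator {c..d} t *\<^sub>R (L t / t)"
    have k0: "0 \<le> ?k t" for t using L0[of t] cd by (auto simp: indicator_def)
    show "0 \<le> J c d"
      unfolding J_def set_lebesgue_integral_def using k0 by (intro integral_nonneg_AE) auto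
    have "ennreal (J c d) = (\<integral>\<^sup>+t. ennreal (?k t) \<partial>lebesgue)"
      unfolding J_def set_lebesgue_integral_def
      using int[OF cd] k0 by (intro nn_integral_eq_integral[symmetric]) (auto simp: set_integrable_def)
    also have "\<dots> = (\<integral>\<^sup>+t. ennreal (?k t) \<partial>lborel)" by (rule nn_integral_completion)
    also have "\<dots> = emeasure N {c..d}"
      unfolding N[of "{c..d}", simplified]
    proof (rule nn_integral_cong_AE)
      show "AE t in lborel. ennreal (?k t) = ennreal (g t) * indicator {c..d} t"
        using ae by eventually_elim (use cd in \<open>auto simp: indicator_def\<close>)
    qed
    finally show "emeasure N {c..d} = ennreal (J c d)" by simp
  qed
  have N0: "emeasure N {..0} = 0"
    using gneg by (subst N) (auto simp: nn_integral_0_iff_AE indicator_def)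
  have near0: "emeasure N {0<..a} < \<infinity>"
    by (rule emeasure_Ioc_finite_if_tail_integrals_converge[OF sets a J(2) J(1) l[folded J_def]])
  have fin: "emeasure N {0..x} < \<infinity>" for x
  proof -
    have "emeasure N {0..x} \<le> emeasure N ({..0} \<union> ({0<..a} \<union> {a..x}))"
      by (intro emeasure_mono) (auto simp: sets)
    also have "\<dots> \<le> emeasure N {..0} + (emeasure N {0<..a} + emeasure N {a..x})"
      by (intro order_trans[OF emeasure_subadditive] add_left_mono emeasure_subadditive) (auto simp: sets)
    also have "\<dots> < \<infinity>"
    proof (cases "a \<le> x")
      case True
      then show ?thesis using N0 near0 J(2)[OF a True] by simp
    next
      case False
      then show ?thesis using N0 near0 by simp
    qed
    finally show ?thesis .
  qed
  define G where "G x = enn2real (emeasure N {0..x})" for x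
  have NG: "emeasure N {0..x} = ennreal (G x)" for x using fin[of x] by (simp add: G_def)
  have G0: "0 \<le> G x" for x by (simp add: G_def)
  have G: "(\<integral>\<^sup>+s\<in>{0..t}. ennreal (g s) \<partial>lborel) = ennreal (G t)" for t
    using NG[of t] by (simp add: N)
  have JG: "J a x \<le> G x" if "a \<le> x" for x
  proof -
    have "ennreal (J a x) \<le> ennreal (G x)"
      unfolding J(2)[OF a that, symmetric] NG[symmetric] using a by (intro emeasure_mono) (auto simp: sets)
    then show ?thesis by (simp add: G0 ennreal_le_iff)
  qed
  have Glim: "filterlim G at_top at_top"
    by (rule filterlim_at_top_mono[OF lim[folded J_def]])
       (rule eventually_mono[OF eventually_ge_at_top[of a] JG])
  have int0: "(\<integral>\<^sup>+s\<in>{0<..x}. ennreal (g s) \<partial>lborel) = ennreal (G x)" for x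
    unfolding G[symmetric] using gneg by (intro nn_integral_cong) (auto simp: indicator_def)
  have ae': "AE s in lborel. s \<in> {0<..x} \<longrightarrow> L s / s = g s" for x
    using ae by eventually_elim auto
  show thesis
    by (rule that[OF gm g0 gneg G0 G Glim ae])
       (auto intro!: absolutely_integrable_set_integral_from_nn_integral[OF gm _ g0 ae' int0 G0])
qed

section \<open>Inversion and characterization of the intensity\<close>

theorem theorem3p2:
  fixes \<alpha> :: real
  assumes "\<alpha> > 0"
  shows
    "(\<forall>(M :: 'a measure) (X :: 'a \<Rightarrow> real) (F :: real \<Rightarrow> real) (L :: real \<Rightarrow> real).
        prob_space M \<and>
        (AE \<omega> in M. 0 \<le> X \<omega>) \<and>
        (\<exists>f. distributed M lborel X f) \<and>
        F = cdf (distr M borel X) \<and>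
        (\<forall>x>0. F x < 1) \<and>
        is_gra_intensity \<alpha> F L
        \<longrightarrow>
        (\<forall>x>0. (\<lambda>t. L t / t) absolutely_integrable_on {0<..x} \<and>
               F x = (1 - exp (- (LINT t:{0<..x}|lebesgue. L t / t))) powr (1 / \<alpha>)))
     \<and>
     (\<forall>(a :: real) (L :: real \<Rightarrow> real).
        0 < a \<and>
        L \<in> borel_measurable (lebesgue_on {0<..}) \<and>
        (\<forall>c d. 0 < c \<and> c \<le> d \<longrightarrow> (\<lambda>t. L t / t) absolutely_integrable_on {c..d}) \<and>
        (\<forall>x>0. 0 \<le> L x) \<and>
        (\<exists>l::real. ((\<lambda>x. LINT t:{x..a}|lebesgue. L t / t) \<longlongrightarrow> l) (at_right 0)) \<and>
        filterlim (\<lambda>x. LINT t:{a..x}|lebesgue. L t / t) at_top at_top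
        \<longrightarrow>
        (let I = (\<lambda>x. LINT t:{0<..x}|lebesgue. L t / t);
             rel = (\<lambda>F :: real \<Rightarrow> real. \<forall>x>0.
                      F x = 1 - gen_pareto_cdf \<alpha> (1 / \<alpha> * exp (- I x)) \<and>
                      F x = (1 - exp (- I x)) powr (1 / \<alpha>))
         in (\<forall>x>0. (\<lambda>t. L t / t) absolutely_integrable_on {0<..x}) \<and>
            (\<exists>F. ac_cdf F \<and> (\<forall>x\<le>0. F x = 0) \<and> (\<forall>x>0. F x < 1) \<and> rel F \<and>
                 is_gra_intensity \<alpha> F L \<and>
                 (\<forall>G. ac_cdf G \<and> (\<forall>x\<le>0. G x = 0) \<and> rel G \<longrightarrow> G = F))))"
proof ((rule conjI; intro allI impI), goal_cases)
  case (1 M X F L x)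
  then obtain f where d: "cdf_has_density F f"
    and L: "AE x in lborel. x > 0 \<longrightarrow> L x = gra_intensity \<alpha> F f x"
    by (auto simp: is_gra_intensity_def AE_completion_iff)
  have "X \<in> borel_measurable M"
    using 1 by (auto dest: distributed_measurable)
  then have "AE s in lborel. s < 0 \<longrightarrow> f s = 0"
    using 1 d by (intro density_zero_on_negatives[of M X]) auto
  then show ?case
    using gra_intensity_inversion[OF assms d _ _ L] 1 by blast
next
  case (2 a L)
  then obtain l where l: "((\<lambda>x. LINT t:{x..a}|lebesgue. L t / t) \<longlongrightarrow> l) (at_right 0)"
    by blast
  obtain g G where g: "g \<in> borel_measurable borel" "\<And>s. 0 \<le> g s" "\<And>s. s \<le> 0 \<Longrightarrow> g s = 0"
    and G0: "\<And>t. 0 \<le> G t" and G: "\<And>t. (\<integral>\<^sup>+s\<in>{0..t}. ennreal (g s) \<partial>lborel) = ennreal (G t)"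
    and Glim: "filterlim G at_top at_top" and ae: "AE t in lborel. 0 < t \<longrightarrow> L t / t = g t"
    and int: "\<And>x. 0 < x \<Longrightarrow> (\<lambda>t. L t / t) absolutely_integrable_on {0<..x}"
    and I: "\<And>x. 0 < x \<Longrightarrow> (LINT t:{0<..x}|lebesgue. L t / t) = G x"
    by (rule borel_density_of_cumulative_intensity[of a L l]) (use 2 l in blast)+
  define F where "F x = (1 - exp (- G x)) powr (1 / \<alpha>)" for x
  obtain f where f: "cdf_has_density F f"
    "AE x in lborel. x > 0 \<longrightarrow> L x = gra_intensity \<alpha> F f x" and F0: "\<And>x. x \<le> 0 \<Longrightarrow> F x = 0"
    using gra_intensity_realization[OF assms g G0 G Glim ae, folded F_def] by blast
  have F1: "F x < 1" for x
    using powr_less_mono2[of "1 / \<alpha>" "1 - exp (- G x)" 1] assms G0[of x] by (simp add: F_def)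
  have eq: "1 - gen_pareto_cdf \<alpha> (1 / \<alpha> * exp (- G x)) = F x" for x
    unfolding F_def by (rule gen_pareto_cdf_exp[OF assms G0])
  have uniq: "H = F" if "\<forall>x\<le>0. H x = 0" "\<forall>x>0. H x = F x" for H :: "real \<Rightarrow> real"
    using that F0 by (intro ext) (metis linorder_not_less)
  show ?case
    unfolding Let_def
  proof (intro conjI exI[of _ F] allI impI)
    show "ac_cdf F" using f by (auto simp: ac_cdf_def)
    show "is_gra_intensity \<alpha> F L"
      using f by (auto simp: is_gra_intensity_def AE_completion_iff)
  qed (use int F0 F1 in \<open>auto simp: I eq[simplified] F_def[symmetric] intro: uniq\<close>)
qed

end
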